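(* Let $G$ be a finite non-trivial group of order $n$ with identity $e$, let $S\subseteq G\setminus\{e\}$ satisfy $S=S^{-1}$ and $G=\langle S\rangle$, and let $\Gamma_G=\mathrm{Cay}(S:G)$. If $\gamma_{S}(\Gamma_G)=n-2$, then $G$ is isomorphic to one of $\mathbb{Z}_3$, $\mathbb{Z}_2\times\mathbb{Z}_2$, $\mathbb{Z}_4$, $\mathbb{Z}_5$, $S_3$, $\mathbb{Z}_6$, $\mathbb{Z}_8$, $D_8$.
   Context: $\mathrm{Cay}(S:G)$ is the simple graph with vertex set $G$ in which $a$ and $b$ are adjacent if and only if $ab^{-1}\in S$. For a graph $\Gamma$, $N[v]$ denotes the closed neighborhood of $v$ (the vertex $v$ together with all its neighbors). A signed dominating function of $\Gamma$ is a function $g:V(\Gamma)\to\{-1,1\}$ with $\sum_{u\in N[v]}g(u)>0$ for every $v\in V(\Gamma)$; its weight is $\sum_{v\in V(\Gamma)}g(v)$. The signed domination number $\gamma_{S}(\Gamma)$ is the minimum weight of a signed dominating function of $\Gamma$ (the subscript $S$ in $\gamma_S$ is part of the notation and unrelated to the set $S$). $S_3$ is the symmetric group on three letters and $D_8$ is the dihedral group of order $8$. *)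

theory Defs
  imports "HOL-Algebra.Algebra" "Graph_Theory.Pair_Digraph"
begin

text \<open>
  A finite simple graph is represented as a \<^locale>\<open>pair_graph\<close>: each edge is a pair of opposite
  arcs. The Cayley graph below is of this kind when \<open>S\<close> is inverse-closed and omits the identity,
  see \<open>pair_graph_cayley_graph\<close>.
\<close>

definition cayley_graph :: "('a, 'b) monoid_scheme \<Rightarrow> 'a set \<Rightarrow> 'a pair_pre_digraph" where
  "cayley_graph G S =
     \<lparr> pverts = carrier G,
       parcs = {(a, b). a \<in> carrier G \<and> b \<in> carrier G \<and> a \<otimes>\<^bsub>G\<^esub> inv\<^bsub>G\<^esub> b \<in> S} \<rparr>"

definition closed_neighborhood :: "'a pair_pre_digraph \<Rightarrow> 'a \<Rightarrow> 'a set" where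
  "closed_neighborhood \<Gamma> v = insert v {u. (v, u) \<in> parcs \<Gamma>}"

definition signed_dominating :: "'a pair_pre_digraph \<Rightarrow> ('a \<Rightarrow> int) \<Rightarrow> bool" where
  "signed_dominating \<Gamma> g \<longleftrightarrow>
     g \<in> pverts \<Gamma> \<rightarrow>\<^sub>E {-1, 1} \<and> (\<forall>v\<in>pverts \<Gamma>. (\<Sum>u\<in>closed_neighborhood \<Gamma> v. g u) > 0)"

definition signed_weight :: "'a pair_pre_digraph \<Rightarrow> ('a \<Rightarrow> int) \<Rightarrow> int" where
  "signed_weight \<Gamma> g = (\<Sum>v\<in>pverts \<Gamma>. g v)"

definition signed_domination_number :: "'a pair_pre_digraph \<Rightarrow> int" where
  "signed_domination_number \<Gamma> = Min (signed_weight \<Gamma> ` {g. signed_dominating \<Gamma> g})"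

text \<open>
  The dihedral group of order \<open>2 * n\<close>, for \<open>n > 0\<close>: the pair \<open>(i, s)\<close> stands for \<open>\<rho>\<^sup>i\<close> if \<open>s\<close> is
  \<^const>\<open>False\<close> and for \<open>\<rho>\<^sup>i \<sigma>\<close> if \<open>s\<close> is \<^const>\<open>True\<close>, where \<open>\<rho>\<close> is a rotation of order \<open>n\<close>,
  \<open>\<sigma>\<close> a reflection, and \<open>\<sigma> \<rho> = \<rho>\<^sup>-\<^sup>1 \<sigma>\<close>.
\<close>

definition dihedral_group :: "nat \<Rightarrow> (int \<times> bool) monoid" where
  "dihedral_group n =
     \<lparr> carrier = {0..<int n} \<times> UNIV,
       monoid.mult = (\<lambda>(i, s) (j, t). ((if s then i - j else i + j) mod int n, s \<noteq> t)),
       one = (0, False) \<rparr>"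

lemma group_dihedral_group:
  assumes "n > 0"
  shows "group (dihedral_group n)"
proof (rule groupI)
  fix x assume "x \<in> carrier (dihedral_group n)"
  then obtain i s where x: "x = (i, s)" "0 \<le> i" "i < int n"
    by (auto simp: dihedral_group_def)
  show "\<exists>y\<in>carrier (dihedral_group n). y \<otimes>\<^bsub>dihedral_group n\<^esub> x = \<one>\<^bsub>dihedral_group n\<^esub>"
    using x assms
    by (intro bexI[of _ "(if s then i else (- i) mod int n, s)"])
       (auto simp: dihedral_group_def mod_simps)
qed (use assms in \<open>auto simp: dihedral_group_def mod_simps algebra_simps split: if_splits\<close>)

lemma order_dihedral_group: "order (dihedral_group n) = 2 * n"
  by (simp add: order_def dihedral_group_def card_cartesian_product)

lemma pair_graph_cayley_graph:
  fixes G (structure)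
  assumes "group G" "finite (carrier G)"
    and S: "S \<subseteq> carrier G - {\<one>}" "set_inv S = S"
  shows "pair_graph (cayley_graph G S)"
proof -
  interpret group G by fact
  have "b \<otimes> inv a \<in> S" if "a \<in> carrier G" "b \<in> carrier G" "a \<otimes> inv b \<in> S" for a b
  proof -
    have "inv (a \<otimes> inv b) \<in> S"
      using that S(2) by (auto simp: SET_INV_def)
    then show ?thesis
      using that by (simp add: inv_mult_group)
  qed
  moreover have "finite (parcs (cayley_graph G S))"
    by (rule finite_subset[of _ "carrier G \<times> carrier G"])
       (use assms(2) in \<open>auto simp: cayley_graph_def\<close>)
  ultimately show ?thesis
    using assms
    by unfold_locales
       (auto simp: cayley_graph_def symmetric_def sym_def split: if_splits)
qed

lemma finite_signed_dominating:
  assumes "finite (pverts \<Gamma>)"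
  shows "finite {g. signed_dominating \<Gamma> g}"
  by (rule finite_subset[of _ "pverts \<Gamma> \<rightarrow>\<^sub>E {-1, 1}"])
     (use assms in \<open>auto simp: signed_dominating_def intro!: finite_PiE\<close>)

lemma (in pair_graph) signed_dominating_one: "signed_dominating G (\<lambda>v\<in>pverts G. 1)"
proof -
  have "closed_neighborhood G v \<subseteq> pverts G" if "v \<in> pverts G" for v
    using that in_arcsD2 by (auto simp: closed_neighborhood_def)
  moreover from this have "finite (closed_neighborhood G v)" if "v \<in> pverts G" for v
    using that pair_finite_verts finite_subset by blast
  moreover have "closed_neighborhood G v \<noteq> {}" for v
    by (simp add: closed_neighborhood_def)
  ultimately show ?thesis
    by (auto simp: signed_dominating_def subset_eq card_gt_0_iff)
qed

end

theory Submission
  imports Defs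
begin

text \<open>
  Put \<open>T = S \<union> {\<one>}\<close>, so that closed neighbourhoods are the right translates \<open>T v\<close>. Some signed
  dominating function takes the value \<open>-1\<close>, whence \<open>|T| \<ge> 3\<close>; no two vertices can both be given
  the value \<open>-1\<close>, so any two lie in a common closed neighbourhood and \<open>|T| \<le> 4\<close>. Hence
  \<open>G = T T\<close> has at most 10 elements. If the generators commute, counting \<open>T T\<close> leaves only
  cyclic groups and the Klein four-group. Otherwise some involution inverts an element whose powers
  form a subgroup of index two, and counting excludes the dihedral group of order 10.
\<close>

section \<open>Recognising cyclic and dihedral groups\<close>

text \<open>The map goes from the concrete model \<open>H\<close> into \<open>G\<close>: a trivial
  kernel makes it injective, and equal finite cardinalities make it onto. Only then is the
  isomorphism inverted.\<close>

lemma (in group) iso_of_hom_trivial_kernel: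
  assumes "finite (carrier G)" "group H" "h \<in> hom H G" "card (carrier H) = order G"
    and "\<And>x. x \<in> carrier H \<Longrightarrow> h x = \<one> \<Longrightarrow> x = \<one>\<^bsub>H\<^esub>"
  shows "G \<cong> H"
proof -
  interpret h: group_hom H G h
    by (simp add: assms group_hom_axioms_def group_hom_def)
  have "inj_on h (carrier H)"
    using assms(5) by (simp add: h.inj_on_one_iff)
  moreover from this have "h ` carrier H = carrier G"
    using assms(1,4) by (intro card_subset_eq) (auto simp: card_image order_def)
  ultimately have "H \<cong> G"
    using assms(3) by (intro is_isoI isoI) (auto simp: bij_betw_def)
  then show ?thesis
    by (rule group.iso_sym[OF assms(2)])
qed

lemma (in group) int_pow_mod_ord:
  assumes "x \<in> carrier G"
  shows "x [^] (i mod int (ord x)) = x [^] (i :: int)"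
  using assms by (simp add: int_pow_eq)

lemma (in group) iso_integer_mod_group:
  assumes "finite (carrier G)" "x \<in> carrier G" "ord x = order G"
  shows "G \<cong> integer_mod_group (order G)"
proof -
  have n: "order G > 0"
    using assms(1) by (simp add: order_gt_0_iff_finite)
  show ?thesis
  proof (rule iso_of_hom_trivial_kernel[where h = "\<lambda>i. x [^] (i :: int)"])
    show "(\<lambda>i. x [^] i) \<in> hom (integer_mod_group (order G)) G"
      using assms(2,3) int_pow_mod_ord[of x]
      by (auto simp: hom_def int_pow_mult)
    show "card (carrier (integer_mod_group (order G))) = order G"
      using n by (simp add: carrier_integer_mod_group)
    show "i = \<one>\<^bsub>integer_mod_group (order G)\<^esub>"
      if "i \<in> carrier (integer_mod_group (order G))" "x [^] i = \<one>" for i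
      using that n assms by (auto simp: carrier_integer_mod_group int_pow_eq_id zdvd_not_zless
          order_le_less)
  qed (use assms in auto)
qed

text \<open>Used in contrapositive form: failure to commute with \<open>r\<close> certifies that an
  element lies outside the cyclic subgroup of \<open>r\<close>.\<close>

lemma (in group) commutes_of_mem_generate_singleton:
  assumes "r \<in> carrier G" "t \<in> generate G {r}"
  shows "t \<otimes> r = r \<otimes> t"
proof -
  obtain k :: int where "t = r [^] k"
    using assms by (auto simp: generate_pow)
  moreover have "r [^] k \<otimes> r [^] (1 :: int) = r [^] (1 :: int) \<otimes> r [^] k"
    using assms(1) by (metis add.commute int_pow_mult)
  ultimately show ?thesis
    using assms(1) by simp
qed

text \<open>Conjugation by \<open>t\<close> is an automorphism, so sending \<open>r\<close> to
  \<open>c\<close> it sends powers of \<open>r\<close> to powers of \<open>c\<close>; the form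
  without \<open>inv t\<close> suits rewriting.\<close>

lemma (in group) conjugate_nat_pow:
  assumes "t \<in> carrier G" "r \<in> carrier G" "c \<in> carrier G" "t \<otimes> r = c \<otimes> t"
  shows "t \<otimes> r [^] (j :: nat) = c [^] j \<otimes> t"
proof (induction j)
  case (Suc j)
  have "t \<otimes> (r [^] j \<otimes> r) = c [^] j \<otimes> (t \<otimes> r)"
    using Suc assms(1-3) by (simp flip: m_assoc)
  then show ?case
    using assms by (simp add: m_assoc)
qed (use assms in simp)

text \<open>The normal form \<open>r^i t^s\<close> defines the map from the model. The inversion
  relation makes it multiplicative, \<open>t\<close> lying outside the powers of \<open>r\<close>
  makes its kernel trivial, and the order condition makes it onto.\<close>

lemma (in group) iso_dihedral_group:
  assumes "finite (carrier G)" and r: "r \<in> carrier G" and t: "t \<in> carrier G"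
    and n: "order G = 2 * ord r" and nt: "t \<notin> generate G {r}"
    and tt: "t \<otimes> t = \<one>" and tr: "t \<otimes> r = inv r \<otimes> t"
  shows "G \<cong> dihedral_group (ord r)"
proof -
  define h where "h = (\<lambda>(i :: int, s). r [^] i \<otimes> (if s then t else \<one>))"
  have pos: "ord r > 0"
    using ord_ge_1[OF assms(1) r] by simp
  \<comment> \<open>Nonnegative exponents suffice, because rotation parts in the model lie in
    \<open>{0..<int (ord r)}\<close>.\<close>
  have swap: "t \<otimes> r [^] i = r [^] (- i) \<otimes> t" if i: "i \<ge> 0" for i :: int
  proof -
    obtain j where "i = int j"
      using nonneg_int_cases[OF i] .
    then show ?thesis
      using conjugate_nat_pow[OF t r _ tr, of j] r
      by (simp add: int_pow_neg int_pow_int nat_pow_inv)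
  qed
  have hom: "h (x \<otimes>\<^bsub>dihedral_group (ord r)\<^esub> y) = h x \<otimes> h y"
    if "x \<in> carrier (dihedral_group (ord r))" "y \<in> carrier (dihedral_group (ord r))" for x y
  proof -
    obtain i s j u where xy: "x = (i, s)" "y = (j, u)"
      by (cases x, cases y)
    then have j: "j \<ge> 0"
      using that by (simp add: dihedral_group_def)
    show ?thesis
    proof (cases s)
      case True
      \<comment> \<open>Here \<open>w\<close> stands for the reflection part of the second factor,
        so \<open>t\<close> and the identity are treated at once.\<close>
      have "(r [^] i \<otimes> t) \<otimes> (r [^] j \<otimes> w) = r [^] (i - j) \<otimes> (t \<otimes> w)"
        if "w \<in> carrier G" for w
      proof -
        have "(r [^] i \<otimes> t) \<otimes> (r [^] j \<otimes> w) = r [^] i \<otimes> (t \<otimes> r [^] j) \<otimes> w"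
          using r t that by (simp add: m_assoc)
        also have "\<dots> = (r [^] i \<otimes> r [^] (- j)) \<otimes> (t \<otimes> w)"
          using r t that swap[OF j] by (simp add: m_assoc)
        finally show ?thesis
          using r by (simp flip: int_pow_mult)
      qed
      from this[OF t] this[OF one_closed] show ?thesis
        using True xy r t tt int_pow_mod_ord[OF r]
        by (cases u) (simp_all add: h_def dihedral_group_def)
    next
      case False
      then show ?thesis
        using xy r t int_pow_mod_ord[OF r]
        by (simp add: h_def dihedral_group_def int_pow_mult m_assoc)
    qed
  qed
  have ker: "x = \<one>\<^bsub>dihedral_group (ord r)\<^esub>"
    if x_in: "x \<in> carrier (dihedral_group (ord r))" and hx: "h x = \<one>" for x
  proof -
    obtain i s where x: "x = (i, s)" "0 \<le> i" "i < int (ord r)"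
      using x_in by (cases x) (auto simp: dihedral_group_def)
    \<comment> \<open>A reflection in the kernel would make \<open>t\<close> a power of
      \<open>r\<close>.\<close>
    have "\<not> s"
    proof
      assume s
      then have "r [^] i \<otimes> t = \<one>"
        using hx x by (simp add: h_def)
      then have "t = r [^] (- i)"
        using r t by (metis int_pow_closed int_pow_neg inv_equality inv_inv m_closed)
      then show False
        using nt r by (auto simp: generate_pow)
    qed
    moreover from this have "r [^] i = \<one>"
      using hx x r by (simp add: h_def)
    ultimately show ?thesis
      using x r by (auto simp: int_pow_eq_id dihedral_group_def zdvd_not_zless order_le_less)
  qed
  show ?thesis
  proof (rule iso_of_hom_trivial_kernel[where h = h])
    show "h \<in> hom (dihedral_group (ord r)) G"
      using hom r t by (auto simp: hom_def h_def)
    show "card (carrier (dihedral_group (ord r))) = order G"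
      using order_dihedral_group[of "ord r"] n by (simp add: order_def)
  qed (use assms(1) pos group_dihedral_group ker in auto)
qed

section \<open>Elements of small order\<close>

lemma (in group) ord_eq_2:
  assumes "x \<in> carrier G" "x \<otimes> x = \<one>" "x \<noteq> \<one>"
  shows "ord x = 2"
proof -
  have "ord x dvd 2"
    using assms by (simp add: numeral_2_eq_2 flip: pow_eq_id)
  moreover have "ord x \<noteq> 1"
    using assms by (metis ord_eq_1)
  ultimately show ?thesis
    by (metis prime_nat_iff two_is_prime_nat)
qed

lemma (in group) ord_eq_3:
  assumes "x \<in> carrier G" "x \<otimes> x \<otimes> x = \<one>" "x \<noteq> \<one>"
  shows "ord x = 3"
proof -
  have "ord x dvd 3"
    using assms by (simp add: numeral_3_eq_3 flip: pow_eq_id)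
  moreover have "ord x \<noteq> 1"
    using assms by (metis ord_eq_1)
  moreover have "Factorial_Ring.prime (3 :: nat)"
    by simp
  ultimately show ?thesis
    by (metis prime_nat_iff)
qed

lemma (in group) ord_ge_3:
  assumes "finite (carrier G)" "x \<in> carrier G" "x \<noteq> inv x"
  shows "ord x \<ge> 3"
proof (rule ccontr)
  assume "\<not> ord x \<ge> 3"
  then consider "ord x = 1" | "ord x = 2"
    using ord_ge_1[OF assms(1,2)] by linarith
  then show False
  proof cases
    case 1
    then show ?thesis
      using assms ord_eq_1 by (metis inv_one)
  next
    case 2
    then have "x \<otimes> x = \<one>"
      using assms(2) pow_ord_eq_1[of x] by (simp add: numeral_2_eq_2)
    then show ?thesis
      using assms inv_equality by metis
  qed
qed

lemma (in group) generate_involution: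
  assumes "x \<in> carrier G" "x \<otimes> x = \<one>"
  shows "generate G {x} \<subseteq> {\<one>, x}"
proof -
  have "inv x = x"
    using assms inv_equality by blast
  then have "subgroup {\<one>, x} G"
    using assms by unfold_locales auto
  then show ?thesis
    by (intro generate_subgroup_incl) auto
qed

text \<open>The Klein four-group appears as the dihedral group of order 4: since \<open>r\<close> is
  its own inverse, the inversion relation is just commutation.\<close>

lemma (in group) iso_dihedral_group_2:
  assumes "finite (carrier G)" "order G = 4" "r \<in> carrier G" "t \<in> carrier G"
    and "r \<noteq> \<one>" "t \<noteq> \<one>" "r \<noteq> t" "r \<otimes> r = \<one>" "t \<otimes> t = \<one>" "t \<otimes> r = r \<otimes> t"
  shows "G \<cong> dihedral_group 2"
proof -
  have "ord r = 2"
    using assms by (simp add: ord_eq_2)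
  moreover have "inv r = r"
    using assms inv_equality by blast
  moreover have "t \<notin> generate G {r}"
    using assms generate_involution[of r] by auto
  ultimately show ?thesis
    using iso_dihedral_group[of r t] assms by simp
qed

lemma klein_four_iso_dihedral_group_2:
  "integer_mod_group 2 \<times>\<times> integer_mod_group 2 \<cong> dihedral_group 2" (is "?V \<cong> _")
proof -
  interpret group ?V
    by (intro DirProd_group) auto
  have c: "carrier ?V = {0..<2} \<times> {0..<2}"
    by (simp add: DirProd_def carrier_integer_mod_group)
  show ?thesis
    by (rule iso_dihedral_group_2[of "(1, 0)" "(0, 1)"])
       (unfold order_def c, simp_all add: card_cartesian_product)
qed

lemma sym_group_3_iso_dihedral_group_3: "sym_group 3 \<cong> dihedral_group 3"
proof -
  interpret group "sym_group 3"
    by (rule sym_group_is_group)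
  \<comment> \<open>\<open>r\<close> is the three-cycle sending 1 to 2, 2 to 3 and 3 to 1; with the
    transposition \<open>t\<close> it satisfies the dihedral relations.\<close>
  define r where "r = transpose 1 (2 :: nat) \<circ> transpose 2 3"
  define t where "t = transpose 1 (2 :: nat)"
  have r: "r \<in> carrier (sym_group 3)" and t: "t \<in> carrier (sym_group 3)"
    by (auto simp: r_def t_def sym_group_carrier intro!: permutes_compose permutes_swap_id)
  have rrr: "r \<circ> r \<circ> r = id"
    by (auto simp: r_def fun_eq_iff transpose_def)
  have "r 1 \<noteq> id 1"
    by (simp add: r_def transpose_def)
  then have "r \<noteq> id"
    by metis
  then have ord: "ord r = 3"
    using r rrr by (intro ord_eq_3) (auto simp: sym_group_mult sym_group_one)
  have inv: "m_inv (sym_group 3) r = r \<circ> r"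
    using r rrr by (intro inv_equality) (auto simp: sym_group_mult sym_group_one permutes_compose sym_group_carrier)
  \<comment> \<open>The values are 1 and 3, so \<open>t\<close> and \<open>r\<close> do not
    commute.\<close>
  have "(t \<circ> r) 1 \<noteq> (r \<circ> t) 1"
    by (simp add: r_def t_def transpose_def)
  then have "t \<notin> generate (sym_group 3) {r}"
    using commutes_of_mem_generate_singleton[OF r, of t] by (metis sym_group_mult)
  moreover have "t \<circ> t = id" "t \<circ> r = r \<circ> r \<circ> t"
    by (auto simp: r_def t_def fun_eq_iff transpose_def)
  moreover have "order (sym_group 3) = 6"
    using sym_group_card_carrier[of 3] by (simp add: order_def numeral_3_eq_3)
  moreover have "finite (carrier (sym_group 3))"
    using \<open>order (sym_group 3) = 6\<close> order_gt_0_iff_finite by simp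
  ultimately show ?thesis
    using iso_dihedral_group[OF _ r t] ord inv by (simp add: sym_group_mult sym_group_one)
qed

section \<open>Groups with a large cyclic subgroup\<close>

text \<open>\<open>H\<close> and \<open>H t\<close> are disjoint of equal size, so by counting they
  fill the group.\<close>

lemma (in group) mem_coset_of_index_two:
  assumes "finite (carrier G)" "subgroup H G" "order G = 2 * card H"
    and "t \<in> carrier G" "t \<notin> H" "g \<in> carrier G" "g \<notin> H"
  shows "\<exists>h\<in>H. g = h \<otimes> t"
proof -
  interpret H: subgroup H G by fact
  have inj: "inj_on (\<lambda>h. h \<otimes> t) H"
    using assms(4) by (intro inj_onI) simp
  have disj: "H \<inter> (\<lambda>h. h \<otimes> t) ` H = {}"
  proof (intro equals0I)
    fix x assume "x \<in> H \<inter> (\<lambda>h. h \<otimes> t) ` H"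
    then obtain h where h: "h \<in> H" "h \<otimes> t \<in> H"
      by auto
    then have "inv h \<otimes> (h \<otimes> t) \<in> H"
      by blast
    then show False
      using h assms(4,5) H.subset by (simp add: subset_eq flip: m_assoc)
  qed
  have fin: "finite H"
    using assms(1) H.subset finite_subset by blast
  have "H \<union> (\<lambda>h. h \<otimes> t) ` H = carrier G"
  proof (rule card_subset_eq)
    show "card (H \<union> (\<lambda>h. h \<otimes> t) ` H) = card (carrier G)"
      using card_Un_disjoint[OF fin _ disj] fin inj assms(3)
      by (simp add: card_image order_def)
  qed (use assms(1,4) H.subset in auto)
  then show ?thesis
    using assms(6,7) by blast
qed

text \<open>The moduli 3 and 5 are prime, and the only units modulo 4 are 1 and -1. The first
  modulus with further square roots of 1 is 8.\<close>

lemma sqrt_one_mod_small: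
  fixes q m :: nat
  assumes "m \<in> {3, 4, 5}" "q * q mod m = 1 mod m" "q < m"
  shows "q = 1 \<or> q = m - 1"
proof -
  from assms(1,3) have "q \<in> {0, 1, 2, 3, 4}"
    by auto
  with assms show ?thesis
    by (elim insertE emptyE) simp_all
qed

text \<open>
  Conjugation by \<open>t\<close> maps \<open>r\<close> to some \<open>r\<^sup>k\<close> with \<open>k\<^sup>2 \<equiv> 1\<close> modulo the order of \<open>r\<close>; up to order 5
  this forces \<open>k \<equiv> 1\<close> or \<open>k \<equiv> -1\<close>.
\<close>

lemma (in group) involution_inverts_small_rotation:
  assumes fin: "finite (carrier G)" and r: "r \<in> carrier G" and t: "t \<in> carrier G"
    and n: "order G = 2 * ord r" and m: "ord r \<in> {3, 4, 5}"
    and tt: "t \<otimes> t = \<one>" and nc: "t \<otimes> r \<noteq> r \<otimes> t"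
  shows "t \<otimes> r = inv r \<otimes> t"
proof -
  let ?H = "generate G {r}"
  have H: "subgroup ?H G"
    using r by (intro generate_is_subgroup) simp
  have nt: "t \<notin> ?H"
    using nc commutes_of_mem_generate_singleton[OF r] by blast
  have rH: "r \<in> ?H"
    by (simp add: generate.incl)
  \<comment> \<open>Being outside \<open>?H\<close>, the product \<open>t \<otimes> r\<close> lies
    in the coset \<open>?H t\<close>; its first factor \<open>c\<close> there is the conjugate of
    \<open>r\<close> by \<open>t\<close>.\<close>
  have "t \<otimes> r \<notin> ?H"
  proof
    assume "t \<otimes> r \<in> ?H"
    then have "t \<otimes> r \<otimes> inv r \<in> ?H"
      using H rH by (meson subgroup.m_closed subgroup.m_inv_closed)
    then show False
      using nt r t by (simp add: m_assoc)
  qed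
  then obtain c where c: "c \<in> ?H" "t \<otimes> r = c \<otimes> t"
    using mem_coset_of_index_two[OF fin H _ t nt, of "t \<otimes> r"] n r t
    by (auto simp: generate_pow_card[OF r])
  then obtain k :: nat where k: "c = r [^] k"
    using generate_pow_on_finite_carrier[OF fin r] by auto
  have c': "c \<in> carrier G"
    using k r by simp
  \<comment> \<open>Conjugating twice by the involution \<open>t\<close> restores
    \<open>r\<close>.\<close>
  have "t \<otimes> c = r \<otimes> t"
  proof -
    have "t \<otimes> (c \<otimes> t) = t \<otimes> (t \<otimes> r)"
      using c by simp
    also have "\<dots> = r"
      using r t tt by (simp flip: m_assoc)
    finally have "t \<otimes> c \<otimes> t \<otimes> t = r \<otimes> t"
      using c' t by (simp add: m_assoc)
    then show ?thesis
      using c' t tt by (simp add: m_assoc)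
  qed
  \<comment> \<open>Conjugating \<open>c\<close>, the \<open>k\<close>-th power of \<open>r\<close>,
    gives the \<open>k\<close>-th power of \<open>c\<close>; comparison with the previous step
    yields \<open>k * k\<close> congruent to 1 modulo \<open>ord r\<close>.\<close>
  then have "r \<otimes> t = c [^] k \<otimes> t"
    using conjugate_nat_pow[OF t r c' c(2), of k] k by simp
  then have "r [^] (1 :: int) = r [^] int (k * k)"
    using r t c' k by (simp add: nat_pow_pow int_pow_int del: of_nat_mult)
  then have "int (k * k) mod int (ord r) = int 1 mod int (ord r)"
    using int_pow_eq[OF r, of 1 "int (k * k)"] by (simp only: mod_eq_dvd_iff dvd_diff_commute of_nat_1)
  then have sq: "(k mod ord r) * (k mod ord r) mod ord r = 1 mod ord r"
    by (metis mod_mult_eq of_nat_eq_iff of_nat_mod)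
  have "k mod ord r < ord r"
    using m by auto
  with m sq have "k mod ord r = 1 \<or> k mod ord r = ord r - 1"
    by (intro sqrt_one_mod_small)
  \<comment> \<open>Otherwise \<open>c\<close> would be \<open>r\<close>, and \<open>t\<close> would
    commute with \<open>r\<close>.\<close>
  moreover have "k mod ord r \<noteq> 1"
  proof
    assume "k mod ord r = 1"
    then have "r [^] int k = r [^] (1 :: int)"
      using int_pow_mod_ord[OF r, of "int k"] by (metis of_nat_1 of_nat_mod)
    then show False
      using c k nc r by (simp add: int_pow_int)
  qed
  ultimately have "int k mod int (ord r) = (- 1) mod int (ord r)"
    using m by (auto simp flip: of_nat_mod)
  then have "r [^] int k = r [^] (- 1 :: int)"
    using int_pow_mod_ord[OF r] by metis
  then show ?thesis
    using c k r by (simp add: int_pow_int int_pow_neg)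
qed


text \<open>Let \<open>q\<close> be the index of the powers of \<open>r\<close>. Non-commutation
  excludes \<open>q = 1\<close>, and \<open>ord r \<ge> 3\<close> with at most 10 elements excludes
  \<open>q \<ge> 4\<close>. Index 3 would force order 9, which is odd although \<open>t\<close> has
  order 2.\<close>

lemma (in group) order_eq_twice_ord:
  assumes fin: "finite (carrier G)" and le: "order G \<le> 10"
    and r: "r \<in> carrier G" "r \<noteq> inv r" and t: "t \<in> carrier G" "t \<otimes> t = \<one>"
    and nc: "t \<otimes> r \<noteq> r \<otimes> t"
  shows "order G = 2 * ord r" "ord r \<in> {3, 4, 5}"
proof -
  have m: "ord r \<ge> 3"
    using fin r by (rule ord_ge_3)
  have "t \<noteq> \<one>"
    using nc r by auto
  then have "even (order G)"
    using ord_eq_2[OF t] ord_dvd_group_order[OF t(1)] by simp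
  have "ord r \<noteq> order G"
  proof
    assume "ord r = order G"
    then have "generate G {r} = carrier G"
      using fin r generate_incl[of "{r}"]
      by (intro card_subset_eq) (auto simp: order_def simp flip: generate_pow_card)
    then show False
      using nc t commutes_of_mem_generate_singleton r(1) by blast
  qed
  obtain q where q: "order G = ord r * q"
    using ord_dvd_group_order[OF r(1)] by blast
  have "order G > 0"
    using fin by (simp add: order_gt_0_iff_finite)
  then have "q \<noteq> 0" "q \<noteq> 1"
    using q \<open>ord r \<noteq> order G\<close> by (auto intro: Nat.gr0I)
  moreover have "q < 4"
  proof (rule ccontr)
    assume "\<not> q < 4"
    then have "3 * 4 \<le> ord r * q"
      using m by (intro mult_le_mono) auto
    then show False
      using q le by simp
  qed
  ultimately consider "q = 2" | "q = 3"
    by linarith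
  then have *: "order G = 2 * ord r"
  proof cases
    case 2
    then have "ord r = 3"
      using q le m by simp
    then show ?thesis
      using 2 q \<open>even (order G)\<close> by simp
  qed (use q in simp)
  then show "order G = 2 * ord r" "ord r \<in> {3, 4, 5}"
    using m le by auto
qed

section \<open>Groups that are the square of a small symmetric set\<close>

text \<open>Lists allow an upper bound on the order without deciding which of the listed products
  coincide.\<close>

lemma (in group) order_le_length:
  assumes "carrier G \<subseteq> set xs"
  shows "order G \<le> length xs"
  using card_mono[OF _ assms] card_length[of xs] by (simp add: order_def)

text \<open>All products from \<open>T\<close> are powers of \<open>s\<close>, so \<open>s\<close>
  generates \<open>G\<close>; the exponents run from -2 to 2, whence at most five elements.\<close>

lemma (in group) iso_cyclic_of_square_cover:
  assumes "finite (carrier G)" "s \<in> carrier G" "s \<noteq> inv s"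
    and T: "T = {\<one>, s, inv s}" "\<And>g. g \<in> carrier G \<Longrightarrow> \<exists>x\<in>T. \<exists>y\<in>T. g = x \<otimes> y"
  shows "order G \<in> {3, 4, 5} \<and> G \<cong> integer_mod_group (order G)"
proof -
  let ?H = "generate G {s}"
  have H: "subgroup ?H G"
    using assms(2) by (intro generate_is_subgroup) simp
  have "T \<subseteq> ?H"
    by (auto simp: T generate.one generate.incl generate.inv)
  then have "?H = carrier G"
    using T(2) subgroup.m_closed[OF H] subgroup.subset[OF H] by blast
  then have "ord s = order G"
    by (simp add: generate_pow_card assms(2) order_def)
  moreover have "carrier G \<subseteq> set [\<one>, s, inv s, s \<otimes> s, inv s \<otimes> inv s]"
  proof
    fix g assume "g \<in> carrier G"
    from T(2)[OF this] show "g \<in> set [\<one>, s, inv s, s \<otimes> s, inv s \<otimes> inv s]"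
      unfolding T(1) using assms(2) by (elim bexE insertE emptyE) simp_all
  qed
  then have "order G \<le> 5"
    by - (drule order_le_length, simp)
  ultimately show ?thesis
    using ord_ge_3[OF assms(1-3)] iso_integer_mod_group[OF assms(1,2)] by auto
qed

lemma small_divisors:
  fixes m :: nat
  shows "m dvd 4 \<Longrightarrow> m \<in> {1, 2, 4}" "m dvd 6 \<Longrightarrow> m \<in> {1, 2, 3, 6}" "m dvd 8 \<Longrightarrow> m \<in> {1, 2, 4, 8}"
proof -
  have cases: "m \<in> {0, 1, 2, 3, 4, 5, 6, 7, 8}" if "m dvd k" "0 < k" "k \<le> 8" for k
    using dvd_imp_le[OF that(1,2)] that(3) by auto
  show "m \<in> {1, 2, 4}" if "m dvd 4"
    using cases[OF that] that by auto
  show "m \<in> {1, 2, 3, 6}" if "m dvd 6"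
    using cases[OF that] that by auto
  show "m \<in> {1, 2, 4, 8}" if "m dvd 8"
    using cases[OF that] that by auto
qed

text \<open>If \<open>t\<close> commutes with \<open>s\<close>, the order is 4, 6 or 8, and
  \<open>s\<close> or \<open>s \<otimes> t\<close> is a generator. Otherwise \<open>s\<close> is a
  rotation of order 3 or 4 inverted by the reflection \<open>t\<close>.\<close>

lemma (in group) iso_of_square_cover_noninvolution:
  assumes fin: "finite (carrier G)" and s: "s \<in> carrier G" "s \<noteq> inv s"
    and t: "t \<in> carrier G" "t \<otimes> t = \<one>" "t \<noteq> \<one>" and ge: "order G \<ge> 4"
    and T: "T = {\<one>, s, inv s, t}" "\<And>g. g \<in> carrier G \<Longrightarrow> \<exists>x\<in>T. \<exists>y\<in>T. g = x \<otimes> y"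
  shows "order G \<in> {4, 6, 8} \<and> G \<cong> integer_mod_group (order G) \<or>
    G \<cong> dihedral_group 3 \<or> G \<cong> dihedral_group 4"
proof -
  \<comment> \<open>Either relation moves \<open>t\<close> to the right of \<open>s\<close> and
    \<open>inv s\<close>, which removes two of the ten candidate products.\<close>
  have small: "carrier G \<subseteq> set [\<one>, s, inv s, t, s \<otimes> s, inv s \<otimes> inv s, s \<otimes> t, inv s \<otimes> t]"
    if ts: "t \<otimes> s = s \<otimes> t \<and> t \<otimes> inv s = inv s \<otimes> t \<or> t \<otimes> s = inv s \<otimes> t \<and> t \<otimes> inv s = s \<otimes> t"
  proof
    fix g assume "g \<in> carrier G"
    from T(2)[OF this]
    show "g \<in> set [\<one>, s, inv s, t, s \<otimes> s, inv s \<otimes> inv s, s \<otimes> t, inv s \<otimes> t]"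
      unfolding T(1) using s(1) t(1,2) ts by (elim bexE insertE emptyE) auto
  qed
  have m: "ord s \<ge> 3" "ord s dvd order G"
    using fin s ord_ge_3 ord_dvd_group_order by auto
  have "ord t = 2"
    using t by (rule ord_eq_2)
  then have even: "even (order G)"
    using t(1) ord_dvd_group_order by metis
  show ?thesis
  proof (cases "t \<otimes> s = s \<otimes> t")
    case comm: True
    have "t \<otimes> inv s = inv s \<otimes> t"
      using comm s(1) t(1) by (metis inv_closed inv_solve_left inv_solve_right m_assoc m_closed)
    note cover = small[OF disjI1[OF conjI[OF comm this]]]
    have "order G \<le> 8"
      using order_le_length[OF cover] by simp
    with even ge have "order G = 4 \<or> order G = 6 \<or> order G = 8"
      by presburger
    then consider "order G = 4" | "order G = 6" | "order G = 8"
      by blast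
    then show ?thesis
    proof cases
      case 1
      with m small_divisors(1) have "ord s = 4"
        by fastforce
      then show ?thesis
        using 1 iso_integer_mod_group[OF fin s(1)] by simp
    next
      case 2
      have st: "s \<otimes> t \<in> carrier G"
        using s t by simp
      have pow: "(s \<otimes> t) [^] k = s [^] k \<otimes> t [^] k" for k :: nat
        using comm s(1) t(1) by (intro pow_mult_distrib) simp_all
      consider "ord s = 3" | "ord s = 6"
        using m 2 small_divisors(2)[of "ord s"] by auto
      then show ?thesis
      proof cases
        case 1
        \<comment> \<open>The square of \<open>s \<otimes> t\<close> is that of \<open>s\<close> and
          its cube is \<open>t\<close>; both are nontrivial, so its order divides 6 but neither 2
          nor 3.\<close>
        have "(s \<otimes> t) [^] (2 :: nat) \<noteq> \<one>"
          using pow[of 2] \<open>ord t = 2\<close> 1 s(1) t(1) pow_eq_id[OF s(1), of 2] pow_eq_id[OF t(1), of 2] by simp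
        moreover have "(s \<otimes> t) [^] (3 :: nat) \<noteq> \<one>"
          using pow[of 3] \<open>ord t = 2\<close> 1 s(1) t(1) pow_eq_id[OF s(1), of 3] pow_eq_id[OF t(1), of 3] by simp
        ultimately have "\<not> ord (s \<otimes> t) dvd 2" "\<not> ord (s \<otimes> t) dvd 3"
          using st by (auto simp: pow_eq_id)
        moreover have "ord (s \<otimes> t) dvd 6"
          using ord_dvd_group_order[OF st] 2 by simp
        ultimately have "ord (s \<otimes> t) = 6"
          using small_divisors(2)[of "ord (s \<otimes> t)"] by auto
        then show ?thesis
          using 2 iso_integer_mod_group[OF fin st] by simp
      next
        case 2
        then show ?thesis
          using \<open>order G = 6\<close> iso_integer_mod_group[OF fin s(1)] by simp
      qed
    next
      case 3
      consider "ord s = 4" | "ord s = 8"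
        using m 3 small_divisors(3)[of "ord s"] by auto
      then show ?thesis
      proof cases
        case 1
        \<comment> \<open>If \<open>s\<close> has order 4, then \<open>s\<close> and
          \<open>inv s\<close> have the same square, and seven products cannot cover eight
          elements.\<close>
        then have "(s \<otimes> s) \<otimes> (s \<otimes> s) = \<one>"
          using pow_ord_eq_1[OF s(1)] s(1) by (simp add: numeral_eq_Suc m_assoc)
        then have "inv s \<otimes> inv s = s \<otimes> s"
          using s(1) inv_equality[of "s \<otimes> s" "s \<otimes> s"] by (simp add: inv_mult_group)
        then have "carrier G \<subseteq> set [\<one>, s, inv s, t, s \<otimes> s, s \<otimes> t, inv s \<otimes> t]"
          using cover by simp
        from order_le_length[OF this] show ?thesis
          using 3 by simp
      next
        case 2
        then show ?thesis
          using 3 iso_integer_mod_group[OF fin s(1)] by simp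
      qed
    qed
  next
    case nc: False
    \<comment> \<open>This crude bound of ten already yields the inversion relation, which in turn
      sharpens the bound to eight and excludes \<open>ord s = 5\<close>.\<close>
    have "carrier G \<subseteq> set [\<one>, s, inv s, t, s \<otimes> s, inv s \<otimes> inv s, s \<otimes> t, inv s \<otimes> t, t \<otimes> s, t \<otimes> inv s]"
    proof
      fix g assume "g \<in> carrier G"
      from T(2)[OF this]
      show "g \<in> set [\<one>, s, inv s, t, s \<otimes> s, inv s \<otimes> inv s, s \<otimes> t, inv s \<otimes> t, t \<otimes> s, t \<otimes> inv s]"
        unfolding T(1) using s(1) t(1,2) by (elim bexE insertE emptyE) auto
    qed
    then have "order G \<le> 10"
      by - (drule order_le_length, simp)
    note n = order_eq_twice_ord[OF fin this s t(1,2) nc]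
    note inv = involution_inverts_small_rotation[OF fin s(1) t(1) n t(2) nc]
    have "t \<otimes> inv s = s \<otimes> t"
      using inv s(1) t(1) by (metis inv_closed inv_solve_left inv_solve_right m_assoc m_closed)
    with inv have "order G \<le> 8"
      using order_le_length[OF small] by simp
    then have "ord s = 3 \<or> ord s = 4"
      using n by auto
    moreover have "t \<notin> generate G {s}"
      using nc commutes_of_mem_generate_singleton[OF s(1)] by blast
    ultimately show ?thesis
      using iso_dihedral_group[OF fin s(1) t(1) n(1) _ t(2) inv] by auto
  qed
qed

text \<open>
  In order 10 the coset of reflections would have to be covered by the three generators, since a
  product of two reflections is a rotation.
\<close>

lemma (in group) iso_of_square_cover_noncommuting_involutions:
  assumes fin: "finite (carrier G)"
    and a: "a \<in> carrier G" "a \<otimes> a = \<one>" and b: "b \<in> carrier G" "b \<otimes> b = \<one>"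
    and c: "c \<in> carrier G" "c \<otimes> c = \<one>" "c \<noteq> \<one>" and nc: "a \<otimes> b \<noteq> b \<otimes> a"
    and T: "T = {\<one>, a, b, c}" "\<And>g. g \<in> carrier G \<Longrightarrow> \<exists>x\<in>T. \<exists>y\<in>T. g = x \<otimes> y"
  shows "G \<cong> dihedral_group 3 \<or> G \<cong> dihedral_group 4"
proof -
  \<comment> \<open>A product of two involutions is inverted by either of them, and it differs from
    its inverse exactly when they do not commute.\<close>
  define r where "r = a \<otimes> b"
  have r: "r \<in> carrier G"
    using a b by (simp add: r_def)
  have inv_ab: "inv a = a" "inv b = b"
    using a b inv_equality by auto
  then have inv_r: "inv r = b \<otimes> a"
    using a b by (simp add: r_def inv_mult_group)
  then have "r \<noteq> inv r"
    using nc by (simp add: r_def)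
  have ar: "a \<otimes> r = b"
    using a b by (simp add: r_def flip: m_assoc)
  have inv: "a \<otimes> r = inv r \<otimes> a"
    using a b by (simp add: ar inv_r m_assoc)
  have nca: "a \<otimes> r \<noteq> r \<otimes> a"
    using inv \<open>r \<noteq> inv r\<close> a r by simp
  have "carrier G \<subseteq> set [\<one>, a, b, c, a \<otimes> b, b \<otimes> a, a \<otimes> c, c \<otimes> a, b \<otimes> c, c \<otimes> b]"
  proof
    fix g assume "g \<in> carrier G"
    from T(2)[OF this]
    show "g \<in> set [\<one>, a, b, c, a \<otimes> b, b \<otimes> a, a \<otimes> c, c \<otimes> a, b \<otimes> c, c \<otimes> b]"
      unfolding T(1) using a b c by (elim bexE insertE emptyE) auto
  qed
  then have "order G \<le> 10"
    by - (drule order_le_length, simp)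
  note n = order_eq_twice_ord[OF fin this r \<open>r \<noteq> inv r\<close> a nca]
  let ?H = "generate G {r}"
  have H: "subgroup ?H G"
    using r by (intro generate_is_subgroup) simp
  have aH: "a \<notin> ?H"
    using nca commutes_of_mem_generate_singleton[OF r] by blast
  have "ord r \<noteq> 5"
  proof
    assume m: "ord r = 5"
    have bH: "b \<notin> ?H"
    proof
      assume "b \<in> ?H"
      moreover have "r \<in> ?H"
        by (simp add: generate.incl)
      ultimately have "r \<otimes> b \<in> ?H"
        using H by (meson subgroup.m_closed)
      then show False
        using aH a b by (simp add: r_def m_assoc)
    qed
    \<comment> \<open>A cyclic group of odd order 5 contains no involution.\<close>
    have cH: "c \<notin> ?H"
    proof
      assume "c \<in> ?H"
      then obtain k :: nat where k: "c = r [^] k"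
        using generate_pow_on_finite_carrier[OF fin r] by auto
      then have "r [^] (k + k) = \<one>"
        using c r by (simp flip: nat_pow_mult)
      then have "5 dvd k + k"
        using r m by (simp only: pow_eq_id)
      then have "5 dvd k"
        by presburger
      then show False
        using k c r m by (simp add: pow_eq_id)
    qed
    have "carrier G - ?H \<subseteq> set [a, b, c]"
    proof
      fix g assume g: "g \<in> carrier G - ?H"
      then obtain x y where xy: "x \<in> T" "y \<in> T" "g = x \<otimes> y"
        using T(2) by blast
      then have xyG: "x \<in> carrier G" "y \<in> carrier G"
        using a b c by (auto simp: T)
      \<comment> \<open>If \<open>y\<close> is outside \<open>?H\<close>, so that
        \<open>?H y\<close> is the other coset, then \<open>x \<otimes> y\<close> outside
        \<open>?H\<close> has the form \<open>h \<otimes> y\<close>; cancelling \<open>y\<close>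
        puts \<open>x\<close> in \<open>?H\<close>.\<close>
      have "x \<in> ?H \<or> y \<in> ?H"
      proof (rule ccontr)
        assume *: "\<not> (x \<in> ?H \<or> y \<in> ?H)"
        then obtain h where "h \<in> ?H" "x \<otimes> y = h \<otimes> y"
          using mem_coset_of_index_two[OF fin H _ xyG(2), of g] g xy(3) n(1)
          by (auto simp: generate_pow_card[OF r])
        then show False
          using * xyG subgroup.mem_carrier[OF H] by simp
      qed
      then have "x = \<one> \<or> y = \<one>"
        using xy aH bH cH by (auto simp: T)
      then have "g \<in> T - {\<one>}"
        using g xy xyG subgroup.one_closed[OF H] by auto
      then show "g \<in> set [a, b, c]"
        by (auto simp: T)
    qed
    then have "card (carrier G - ?H) \<le> card (set [a, b, c])"
      by (intro card_mono) simp_all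
    also have "\<dots> \<le> 3"
      using card_length[of "[a, b, c]"] by simp
    finally have "card (carrier G) - card ?H \<le> 3"
      using card_Diff_subset[OF finite_subset[OF subgroup.subset[OF H] fin] subgroup.subset[OF H]]
      by linarith
    \<comment> \<open>The complement of \<open>?H\<close> has five elements.\<close>
    then show False
      using n(1) m generate_pow_card[OF r] by (simp add: order_def)
  qed
  then have "ord r = 3 \<or> ord r = 4"
    using n by auto
  then show ?thesis
    using iso_dihedral_group[OF fin r a(1) n(1) aH a(2) inv] by auto
qed

text \<open>The two involutions generate a subgroup of order 4; by Lagrange the order of
  \<open>G\<close> is a positive multiple of 4 below 8.\<close>

lemma (in group) iso_dihedral_group_2_of_commuting_involutions:
  assumes fin: "finite (carrier G)" and le: "order G \<le> 7"
    and a: "a \<in> carrier G" "a \<otimes> a = \<one>" "a \<noteq> \<one>" and b: "b \<in> carrier G" "b \<otimes> b = \<one>" "b \<noteq> \<one>"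
    and ab: "a \<noteq> b" "a \<otimes> b = b \<otimes> a"
  shows "G \<cong> dihedral_group 2"
proof -
  let ?H = "{\<one>, a, b, a \<otimes> b}"
  have inv: "inv a = a" "inv b = b"
    using a b inv_equality by auto
  have aab: "a \<otimes> (a \<otimes> b) = b" "b \<otimes> (b \<otimes> a) = a"
    using a b by (simp_all flip: m_assoc)
  have "subgroup ?H G"
  proof
    show "x \<otimes> y \<in> ?H" if "x \<in> ?H" "y \<in> ?H" for x y
      using that a b ab(2) aab by (elim insertE emptyE) (simp_all add: m_assoc)
  qed (use a b inv ab(2) in \<open>auto simp: inv_mult_group\<close>)
  moreover have "a \<otimes> b \<noteq> \<one>" "a \<otimes> b \<noteq> a" "a \<otimes> b \<noteq> b"
    using a b ab inv inv_equality[of a b] by auto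
  then have "card ?H = 4"
    using a b ab(1) by auto
  ultimately have "4 dvd order G"
    using lagrange[of ?H] by (metis dvd_triv_right)
  moreover have "order G > 0"
    using fin by (simp add: order_gt_0_iff_finite)
  ultimately have "order G = 4"
    using le by (auto elim!: dvdE)
  then show ?thesis
    using iso_dihedral_group_2[OF fin _ b(1) a(1)] a b ab by auto
qed

text \<open>If all pairs commute, the products give at most seven elements. Otherwise a
  non-commuting pair is moved to the front, the roles of \<open>a\<close>, \<open>b\<close> and
  \<open>c\<close> in \<open>T\<close> being symmetric.\<close>

lemma (in group) iso_of_square_cover_involutions:
  assumes fin: "finite (carrier G)"
    and a: "a \<in> carrier G" "a \<otimes> a = \<one>" "a \<noteq> \<one>" and b: "b \<in> carrier G" "b \<otimes> b = \<one>" "b \<noteq> \<one>"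
    and c: "c \<in> carrier G" "c \<otimes> c = \<one>" "c \<noteq> \<one>" and ab: "a \<noteq> b"
    and T: "T = {\<one>, a, b, c}" "\<And>g. g \<in> carrier G \<Longrightarrow> \<exists>x\<in>T. \<exists>y\<in>T. g = x \<otimes> y"
  shows "G \<cong> dihedral_group 2 \<or> G \<cong> dihedral_group 3 \<or> G \<cong> dihedral_group 4"
proof (cases "a \<otimes> b = b \<otimes> a \<and> a \<otimes> c = c \<otimes> a \<and> b \<otimes> c = c \<otimes> b")
  case True
  have "carrier G \<subseteq> set [\<one>, a, b, c, a \<otimes> b, a \<otimes> c, b \<otimes> c]"
  proof
    fix g assume "g \<in> carrier G"
    from T(2)[OF this] show "g \<in> set [\<one>, a, b, c, a \<otimes> b, a \<otimes> c, b \<otimes> c]"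
      unfolding T(1) using a b c True by (elim bexE insertE emptyE) auto
  qed
  then have "order G \<le> 7"
    by - (drule order_le_length, simp)
  then show ?thesis
    using iso_dihedral_group_2_of_commuting_involutions[OF fin _ a b ab] True by blast
next
  case False
  then consider "a \<otimes> b \<noteq> b \<otimes> a" | "a \<otimes> c \<noteq> c \<otimes> a" | "b \<otimes> c \<noteq> c \<otimes> b"
    by blast
  then show ?thesis
  proof cases
    case 1
    then show ?thesis
      using iso_of_square_cover_noncommuting_involutions[OF fin a(1,2) b(1,2) c _ T] by blast
  next
    case 2
    have "T = {\<one>, a, c, b}"
      using T(1) by auto
    then show ?thesis
      using iso_of_square_cover_noncommuting_involutions[OF fin a(1,2) c(1,2) b 2 _ T(2)] by blast
  next
    case 3
    have "T = {\<one>, b, c, a}"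
      using T(1) by auto
    then show ?thesis
      using iso_of_square_cover_noncommuting_involutions[OF fin b(1,2) c(1,2) a 3 _ T(2)] by blast
  qed
qed

lemma (in group) iso_of_square_cover_two_involutions:
  assumes fin: "finite (carrier G)"
    and a: "a \<in> carrier G" "a \<otimes> a = \<one>" "a \<noteq> \<one>" and b: "b \<in> carrier G" "b \<otimes> b = \<one>" "b \<noteq> \<one>"
    and ab: "a \<noteq> b"
    and T: "T = {\<one>, a, b}" "\<And>g. g \<in> carrier G \<Longrightarrow> \<exists>x\<in>T. \<exists>y\<in>T. g = x \<otimes> y"
  shows "G \<cong> dihedral_group 2 \<or> G \<cong> dihedral_group 3 \<or> G \<cong> dihedral_group 4"
  \<comment> \<open>Degenerate instance in which the third involution coincides with
    \<open>b\<close>.\<close>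
  by (rule iso_of_square_cover_involutions[OF fin a b b ab, of T]) (use T in auto)

section \<open>Signed domination of Cayley graphs\<close>

text \<open>Each value -1 lowers the sum of the constant function 1 by 2.\<close>

lemma sum_minus_one_one:
  assumes "finite N"
  shows "(\<Sum>u\<in>N. if u \<in> A then -1 else 1 :: int) = int (card N) - 2 * int (card (N \<inter> A))"
proof -
  have "(\<Sum>u\<in>N. if u \<in> A then -1 else 1 :: int) = (\<Sum>u\<in>N. 1 - 2 * (if u \<in> A then 1 else 0))"
    by (intro sum.cong) auto
  then show ?thesis
    using assms by (simp add: sum_subtractf flip: sum_distrib_left sum.inter_restrict)
qed

context group
begin

context
  fixes S
  assumes fin: "finite (carrier G)" and S: "S \<subseteq> carrier G - {\<one>}" "set_inv S = S"
begin

lemma inv_mem_connection_set: "x \<in> S \<Longrightarrow> inv x \<in> S"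
  using S(2) by (auto simp: SET_INV_def)

text \<open>Adjacency puts \<open>v \<otimes> inv u\<close> in \<open>S\<close>; closure under
  inverses turns this into \<open>u \<otimes> inv v\<close>, so neighbours arise by multiplying
  \<open>v\<close> from the left.\<close>

lemma closed_neighborhood_cayley_graph:
  assumes "v \<in> carrier G"
  shows "closed_neighborhood (cayley_graph G S) v = (\<lambda>x. x \<otimes> v) ` insert \<one> S"
proof (intro equalityI subsetI)
  fix u assume "u \<in> closed_neighborhood (cayley_graph G S) v"
  then consider "u = v" | "u \<in> carrier G" "v \<otimes> inv u \<in> S"
    by (auto simp: closed_neighborhood_def cayley_graph_def)
  then show "u \<in> (\<lambda>x. x \<otimes> v) ` insert \<one> S"
  proof cases
    case 2
    then have "u \<otimes> inv v \<in> S"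
      using inv_mem_connection_set[of "v \<otimes> inv u"] assms by (simp add: inv_mult_group)
    moreover have "u = u \<otimes> inv v \<otimes> v"
      using 2 assms by (simp add: m_assoc)
    ultimately show ?thesis
      by blast
  qed (use assms in auto)
next
  fix u assume "u \<in> (\<lambda>x. x \<otimes> v) ` insert \<one> S"
  then consider "u = v" | x where "x \<in> S" "u = x \<otimes> v"
    using assms by auto
  then show "u \<in> closed_neighborhood (cayley_graph G S) v"
  proof cases
    case 2
    then have "x \<in> carrier G"
      using S by auto
    moreover from this have "v \<otimes> inv u = inv x"
      using 2 assms by (simp add: inv_mult_group flip: m_assoc)
    ultimately show ?thesis
      using 2 assms inv_mem_connection_set by (simp add: closed_neighborhood_def cayley_graph_def)
  qed (simp add: closed_neighborhood_def)
qed

lemma card_closed_neighborhood_cayley_graph: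
  assumes "v \<in> carrier G"
  shows "card (closed_neighborhood (cayley_graph G S) v) = card S + 1"
proof -
  have "insert \<one> S \<subseteq> carrier G"
    using S by auto
  then have "inj_on (\<lambda>x. x \<otimes> v) (insert \<one> S)"
    using assms by (intro inj_onI) (meson right_cancel subsetD)
  moreover have "finite S" "\<one> \<notin> S"
    using S fin finite_subset[of S "carrier G"] by auto
  ultimately show ?thesis
    using assms by (simp add: closed_neighborhood_cayley_graph card_image)
qed

lemma closed_neighborhood_cayley_graph_subset:
  "v \<in> carrier G \<Longrightarrow> closed_neighborhood (cayley_graph G S) v \<subseteq> carrier G"
  using S by (auto simp: closed_neighborhood_cayley_graph)

lemma finite_signed_dominating_cayley_graph:
  "finite {g. signed_dominating (cayley_graph G S) g}"
  using fin by (intro finite_signed_dominating) (simp add: cayley_graph_def)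

lemma signed_dominating_cayley_graph_sum:
  assumes "signed_dominating (cayley_graph G S) g" "N \<subseteq> carrier G"
  shows "sum g N = int (card N) - 2 * int (card (N \<inter> {u. g u = -1}))"
proof -
  have "g u = (if u \<in> {u. g u = -1} then -1 else 1)" if "u \<in> N" for u
    using assms that by (auto simp: signed_dominating_def cayley_graph_def)
  then have "sum g N = (\<Sum>u\<in>N. if u \<in> {u. g u = -1} then -1 else 1)"
    by (rule sum.cong[OF refl])
  then show ?thesis
    using sum_minus_one_one[OF finite_subset[OF assms(2) fin], of "{u. g u = -1}"] by simp
qed

text \<open>A function of minimal weight must take the value -1 at some \<open>v\<close>. The closed
  neighbourhood of \<open>v\<close> then has sum at most \<open>card S + 1 - 2\<close>, which must
  be positive.\<close>

lemma card_connection_set_ge_2: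
  assumes "signed_domination_number (cayley_graph G S) < int (order G)"
  shows "card S \<ge> 2"
proof -
  let ?\<Gamma> = "cayley_graph G S"
  have "pair_graph ?\<Gamma>"
    using group_axioms fin S by (intro pair_graph_cayley_graph) auto
  \<comment> \<open>The constant function 1 is dominating, so the minimum is over a nonempty set and
    is attained.\<close>
  then have "{g. signed_dominating ?\<Gamma> g} \<noteq> {}"
    using pair_graph.signed_dominating_one by auto
  then have "signed_domination_number ?\<Gamma> \<in> signed_weight ?\<Gamma> ` {g. signed_dominating ?\<Gamma> g}"
    unfolding signed_domination_number_def
    by (intro Min_in) (simp_all add: finite_signed_dominating_cayley_graph)
  then obtain g where g: "signed_dominating ?\<Gamma> g" "signed_domination_number ?\<Gamma> = signed_weight ?\<Gamma> g"
    by blast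
  have "\<exists>v\<in>carrier G. g v = -1"
  proof (rule ccontr)
    assume "\<not> (\<exists>v\<in>carrier G. g v = -1)"
    then have "carrier G \<inter> {u. g u = -1} = {}"
      by blast
    then show False
      using signed_dominating_cayley_graph_sum[OF g(1), of "carrier G"] assms g(2)
      by (simp add: signed_weight_def cayley_graph_def order_def)
  qed
  then obtain v where v: "v \<in> carrier G" "g v = -1"
    by blast
  let ?N = "closed_neighborhood ?\<Gamma> v"
  have "v \<in> ?N \<inter> {u. g u = -1}" "finite ?N"
    using v fin finite_subset[OF closed_neighborhood_cayley_graph_subset[OF v(1)]]
    by (auto simp: closed_neighborhood_def)
  then have "card (?N \<inter> {u. g u = -1}) \<ge> 1"
    by (metis One_nat_def Suc_leI card_gt_0_iff empty_iff finite_Int)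
  moreover have "sum g ?N > 0"
    using g(1) v(1) by (simp add: signed_dominating_def cayley_graph_def)
  ultimately show ?thesis
    using signed_dominating_cayley_graph_sum[OF g(1) closed_neighborhood_cayley_graph_subset[OF v(1)]]
      card_closed_neighborhood_cayley_graph[OF v(1)] by linarith
qed

text \<open>Flipping the two vertices \<open>g\<close> and \<open>\<one>\<close> must break domination at some closed neighbourhood.\<close>

lemma square_cover_of_signed_domination_number:
  assumes num: "signed_domination_number (cayley_graph G S) = int (order G) - 2"
    and g: "g \<in> carrier G" "g \<noteq> \<one>"
  shows "card S \<le> 3 \<and> (\<exists>x\<in>insert \<one> S. \<exists>y\<in>insert \<one> S. g = x \<otimes> y)"
proof -
  let ?\<Gamma> = "cayley_graph G S"
  define f where "f = (\<lambda>u\<in>carrier G. if u \<in> {g, \<one>} then -1 else 1 :: int)"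
  have sum_f: "sum f N = int (card N) - 2 * int (card (N \<inter> {g, \<one>}))" if "N \<subseteq> carrier G" for N
  proof -
    have "sum f N = (\<Sum>u\<in>N. if u \<in> {g, \<one>} then -1 else 1)"
      using that by (intro sum.cong) (auto simp: f_def)
    then show ?thesis
      using sum_minus_one_one finite_subset[OF that fin] by metis
  qed
  have "carrier G \<inter> {g, \<one>} = {g, \<one>}"
    using g by auto
  \<comment> \<open>With two values -1 the weight is \<open>order G - 4\<close>.\<close>
  then have "signed_weight ?\<Gamma> f < signed_domination_number ?\<Gamma>"
    using sum_f[of "carrier G"] num g(2) by (simp add: signed_weight_def cayley_graph_def order_def)
  moreover have "signed_domination_number ?\<Gamma> \<le> signed_weight ?\<Gamma> f" if "signed_dominating ?\<Gamma> f"
    unfolding signed_domination_number_def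
    using that by (intro Min_le finite_imageI finite_signed_dominating_cayley_graph) simp
  ultimately have "\<not> signed_dominating ?\<Gamma> f"
    by linarith
  moreover have "f \<in> pverts ?\<Gamma> \<rightarrow>\<^sub>E {-1, 1}"
    by (auto simp: f_def cayley_graph_def)
  ultimately obtain v where v: "v \<in> carrier G" "sum f (closed_neighborhood ?\<Gamma> v) \<le> 0"
    unfolding signed_dominating_def by (auto simp: cayley_graph_def not_less)
  let ?N = "closed_neighborhood ?\<Gamma> v"
  \<comment> \<open>A neighbourhood of at least three vertices has nonpositive sum only if it
    contains both flipped vertices; then its size is at most 4.\<close>
  have "int (card S + 1) \<le> 2 * int (card (?N \<inter> {g, \<one>}))"
    using sum_f[OF closed_neighborhood_cayley_graph_subset[OF v(1)]] v
      card_closed_neighborhood_cayley_graph[OF v(1)] by simp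
  moreover have "card S \<ge> 2"
    using card_connection_set_ge_2 num by simp
  ultimately have ge: "card (?N \<inter> {g, \<one>}) \<ge> 2" and le: "card S + 1 \<le> 2 * card (?N \<inter> {g, \<one>})"
    by linarith+
  have "card (?N \<inter> {g, \<one>}) \<le> card {g, \<one>}"
    by (intro card_mono) auto
  moreover have "card {g, \<one>} = 2"
    using g(2) by simp
  ultimately have two: "card (?N \<inter> {g, \<one>}) = card {g, \<one>}"
    using ge by linarith
  then have "?N \<inter> {g, \<one>} = {g, \<one>}"
    by (intro card_subset_eq) auto
  then have "g \<in> ?N" "\<one> \<in> ?N"
    by auto
  then obtain x y where xy: "x \<in> insert \<one> S" "y \<in> insert \<one> S" "g = x \<otimes> v" "\<one> = y \<otimes> v"
    unfolding closed_neighborhood_cayley_graph[OF v(1)] by blast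
  \<comment> \<open>Since \<open>\<one> = y \<otimes> v\<close>, the centre \<open>v\<close> is
    \<open>inv y\<close>, again in \<open>insert \<one> S\<close>; so
    \<open>g = x \<otimes> v\<close> is the wanted product.\<close>
  have "inv y \<in> insert \<one> S"
    using xy(2) inv_mem_connection_set by auto
  moreover have "y \<in> carrier G"
    using xy(2) S by auto
  then have "v = inv y"
    using xy(4) v(1) by (metis inv_equality inv_inv)
  ultimately show ?thesis
    using xy le two \<open>card {g, \<one>} = 2\<close> by auto
qed

end

end

section \<open>From the shape of the connection set to the list of groups\<close>

theorem theorem3p8:
  fixes G (structure) and S :: "'a set" and n :: nat
  assumes "group G" and "finite (carrier G)" and "carrier G \<noteq> {\<one>}" and "order G = n"
    and "S \<subseteq> carrier G - {\<one>}" and "set_inv S = S" and "generate G S = carrier G"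
    and "signed_domination_number (cayley_graph G S) = int n - 2"
  shows "G \<cong> integer_mod_group 3 \<or> G \<cong> integer_mod_group 2 \<times>\<times> integer_mod_group 2 \<or>
         G \<cong> integer_mod_group 4 \<or> G \<cong> integer_mod_group 5 \<or> G \<cong> sym_group 3 \<or>
         G \<cong> integer_mod_group 6 \<or> G \<cong> integer_mod_group 8 \<or> G \<cong> dihedral_group 4"
proof -
  interpret group G by fact
  note S = assms(5,6)
  note inv_S = inv_mem_connection_set[OF assms(2) S]
  have num: "signed_domination_number (cayley_graph G S) = int (order G) - 2"
    using assms by simp
  have V4: "G \<cong> integer_mod_group 2 \<times>\<times> integer_mod_group 2" if "G \<cong> dihedral_group 2"
    using that klein_four_iso_dihedral_group_2
    by (meson DirProd_group group.iso_sym group_integer_mod_group iso_trans)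
  have S3: "G \<cong> sym_group 3" if "G \<cong> dihedral_group 3"
    using that sym_group_3_iso_dihedral_group_3
    by (meson group.iso_sym sym_group_is_group iso_trans)
  have fin_S: "finite S"
    using S assms(2) finite_subset[of S "carrier G"] by auto
  obtain g0 where "g0 \<in> carrier G" "g0 \<noteq> \<one>"
    using assms(3) by blast
  then have "card S \<le> 3"
    using square_cover_of_signed_domination_number[OF assms(2) S num] by blast
  moreover have "card S \<ge> 2"
    using card_connection_set_ge_2[OF assms(2) S] num by simp
  ultimately have card: "card S = 2 \<or> card S = 3"
    by linarith
  define T where "T = insert \<one> S"
  have T: "\<exists>x\<in>T. \<exists>y\<in>T. g = x \<otimes> y" if "g \<in> carrier G" for g
  proof (cases "g = \<one>")
    case False
    then show ?thesis
      using square_cover_of_signed_domination_number[OF assms(2) S num that] by (simp add: T_def)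
  qed (auto simp: T_def)
  \<comment> \<open>For three generators this is the lower bound 4 required when \<open>S\<close>
    contains a non-involution.\<close>
  have ge: "order G \<ge> card S + 1"
  proof -
    have "card T \<le> card (carrier G)"
      using S assms(2) by (intro card_mono) (auto simp: T_def)
    then show ?thesis
      using S fin_S by (auto simp: T_def order_def)
  qed
  show ?thesis
  proof (cases "\<exists>s\<in>S. s \<noteq> inv s")
    case True
    then obtain s where s: "s \<in> S" "s \<noteq> inv s"
      by blast
    then have sG: "s \<in> carrier G"
      using S by blast
    have sub: "{s, inv s} \<subseteq> S"
      using s inv_S by blast
    then have c: "card (S - {s, inv s}) = card S - 2"
      using s fin_S by (simp add: card_Diff_subset)
    from card show ?thesis
    proof
      assume "card S = 2"
      then have "T = {\<one>, s, inv s}"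
        using c sub fin_S by (auto simp: T_def)
      then have "order G \<in> {3, 4, 5} \<and> G \<cong> integer_mod_group (order G)"
        using iso_cyclic_of_square_cover[OF assms(2) sG s(2) _ T] by blast
      then show ?thesis
        by auto
    next
      assume "card S = 3"
      then obtain t where t: "S - {s, inv s} = {t}"
        using c by (auto simp: card_1_singleton_iff)
      then have tS: "t \<in> S" "t \<noteq> s" "t \<noteq> inv s"
        by auto
      then have tG: "t \<in> carrier G" "t \<noteq> \<one>"
        using S by auto
      \<comment> \<open>Inversion preserves \<open>S\<close> and the pair \<open>{s, inv s}\<close>,
        hence fixes the one remaining element \<open>t\<close>.\<close>
      have "inv t \<in> S - {s, inv s}"
        using tS tG sG inv_S[of t] by auto
      then have "t \<otimes> t = \<one>"
        using t tG(1) by (metis r_inv singletonD)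
      moreover have "T = {\<one>, s, inv s, t}"
        using t sub by (auto simp: T_def)
      ultimately have "order G \<in> {4, 6, 8} \<and> G \<cong> integer_mod_group (order G) \<or>
          G \<cong> dihedral_group 3 \<or> G \<cong> dihedral_group 4"
        using iso_of_square_cover_noninvolution[OF assms(2) sG s(2) tG(1) _ tG(2) _ _ T] ge
          \<open>card S = 3\<close> by simp
      then show ?thesis
        using S3 by auto
    qed
  next
    case False
    \<comment> \<open>Every generator is now its own inverse, hence an involution.\<close>
    have invol: "x \<in> carrier G" "x \<otimes> x = \<one>" "x \<noteq> \<one>" if "x \<in> S" for x
      using that S False r_inv[of x] by auto
    have "G \<cong> dihedral_group 2 \<or> G \<cong> dihedral_group 3 \<or> G \<cong> dihedral_group 4"
      using card
    proof
      assume "card S = 2"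
      then obtain a b where "S = {a, b}" "a \<noteq> b"
        by (auto simp: card_2_iff)
      then show ?thesis
        using iso_of_square_cover_two_involutions[OF assms(2) invol[of a] invol[of b] _ _ T]
        by (simp add: T_def)
    next
      assume "card S = 3"
      then obtain a b c where "S = {a, b, c}" "a \<noteq> b"
        by (auto simp: card_3_iff)
      then show ?thesis
        using iso_of_square_cover_involutions[OF assms(2) invol[of a] invol[of b] invol[of c] _ _ T]
        by (simp add: T_def)
    qed
    then show ?thesis
      using V4 S3 by blast
  qed
qed

end
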